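(* Let $A\in\mathbb{R}^{m\times n}$, $y\in\mathbb{R}^m$, $\lambda>0$, and let $f=\tfrac12\|y-\cdot\|_2^2$ on $\mathbb{R}^m$ and $g=\lambda\|\cdot\|_1$ on $\mathbb{R}^n$. Let $P(x)=f(Ax)+g(x)$ and $D(u)=-f^*(-u)-g^*(A^{\top}u)$. Then for every $(x,u)\in\mathrm{dom}(P)\times\mathrm{dom}(-D)$ satisfying $\langle u, Ax\rangle=\lambda\|x\|_1$, $$\mathcal{B}(c_{\mathrm{FNE}},r_{\mathrm{FNE}})=\mathcal{B}_{\mathrm{RYU}}(x,u),$$ where $$c_{\mathrm{FNE}}=u+\tfrac12(y-Ax-u),\qquad r_{\mathrm{FNE}}=\tfrac12\|y-Ax-u\|_2.$$
   Context: $h^*(z^* )=\sup_z \langle z^*,z\rangle-h(z)$ denotes the convex conjugate of $h$, and $\mathrm{dom}(h)=\{z: h(z)<+\infty\}$. $\mathcal{B}(c,r)=\{v\in\mathbb{R}^m:\|v-c\|_2\le r\}$ for $r\ge 0$. For a problem in which $\nabla f$ is $\alpha^{-1}$-Lipschitz and $(x,u)\in\mathrm{dom}(P)\times\mathrm{dom}(-D)$, the RYU ball is $\mathcal{B}_{\mathrm{RYU}}(x,u)=\mathcal{B}(c_{\mathrm{RYU}},r_{\mathrm{RYU}})$ with $c_{\mathrm{RYU}}=\frac12(u-\nabla f(Ax))$ and $r_{\mathrm{RYU}}=\sqrt{\frac{P(x)-D(u)}{\alpha}-\frac{\|u+\nabla f(Ax)\|_2^2}{4}}$; the quantity under the square root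 is nonnegative. Here $f=\frac12\|y-\cdot\|_2^2$ and $\alpha=1$. *)

theory Defs
  imports "HOL-Analysis.Analysis"
begin

definition convex_conjugate :: "('a::real_inner \<Rightarrow> ereal) \<Rightarrow> 'a \<Rightarrow> ereal" where
  "convex_conjugate h w = (SUP z. ereal (w \<bullet> z) - h z)"

definition eff_domain :: "('a \<Rightarrow> ereal) \<Rightarrow> 'a set" where
  "eff_domain h = {z. h z < \<infinity>}"

definition gradient :: "('a::real_inner \<Rightarrow> real) \<Rightarrow> 'a \<Rightarrow> 'a" where
  "gradient f z = (THE d. GDERIV f z :> d)"

text \<open>The data-fidelity term \<open>f\<close> is real-valued because its gradient is used; the
  penalty \<open>g\<close> may be extended-valued.\<close>

definition primal ::
  "real^'n^'m \<Rightarrow> (real^'m \<Rightarrow> real) \<Rightarrow> (real^'n \<Rightarrow> ereal) \<Rightarrow> real^'n \<Rightarrow> ereal" where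
  "primal A f g x = ereal (f (A *v x)) + g x"

definition dual ::
  "real^'n^'m \<Rightarrow> (real^'m \<Rightarrow> real) \<Rightarrow> (real^'n \<Rightarrow> ereal) \<Rightarrow> real^'m \<Rightarrow> ereal" where
  "dual A f g u =
     - convex_conjugate (\<lambda>z. ereal (f z)) (- u) - convex_conjugate g (transpose A *v u)"

definition ryu_center ::
  "real^'n^'m \<Rightarrow> (real^'m \<Rightarrow> real) \<Rightarrow> real^'n \<Rightarrow> real^'m \<Rightarrow> real^'m" where
  "ryu_center A f x u = (1/2) *\<^sub>R (u - gradient f (A *v x))"

text \<open>The conversion \<open>real_of_ereal\<close> is meant for \<open>x\<close> in the domain of the primal
  and \<open>u\<close> in the domain of the negated dual objective, where the duality gap is finite.
  The parameter \<open>\<alpha>\<close> is the inverse of a Lipschitz constant of the gradient of \<open>f\<close>.\<close>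

definition ryu_radius ::
  "real \<Rightarrow> real^'n^'m \<Rightarrow> (real^'m \<Rightarrow> real) \<Rightarrow> (real^'n \<Rightarrow> ereal) \<Rightarrow> real^'n \<Rightarrow> real^'m \<Rightarrow> real" where
  "ryu_radius \<alpha> A f g x u =
     sqrt (real_of_ereal (primal A f g x - dual A f g u) / \<alpha>
           - (norm (u + gradient f (A *v x)))\<^sup>2 / 4)"

definition ryu_ball ::
  "real \<Rightarrow> real^'n^'m \<Rightarrow> (real^'m \<Rightarrow> real) \<Rightarrow> (real^'n \<Rightarrow> ereal) \<Rightarrow> real^'n \<Rightarrow> real^'m
     \<Rightarrow> (real^'m) set" where
  "ryu_ball \<alpha> A f g x u = cball (ryu_center A f x u) (ryu_radius \<alpha> A f g x u)"

definition least_squares :: "real^'m \<Rightarrow> real^'m \<Rightarrow> real" where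
  "least_squares y z = (1/2) * (norm (y - z))\<^sup>2"

definition l1_norm :: "real^'n \<Rightarrow> real" where
  "l1_norm x = (\<Sum>i\<in>UNIV. \<bar>x $ i\<bar>)"

definition l1_penalty :: "real \<Rightarrow> real^'n \<Rightarrow> ereal" where
  "l1_penalty \<mu> x = ereal (\<mu> * l1_norm x)"

definition fne_center :: "real^'n^'m \<Rightarrow> real^'m \<Rightarrow> real^'n \<Rightarrow> real^'m \<Rightarrow> real^'m" where
  "fne_center A y x u = u + (1/2) *\<^sub>R (y - A *v x - u)"

definition fne_radius :: "real^'n^'m \<Rightarrow> real^'m \<Rightarrow> real^'n \<Rightarrow> real^'m \<Rightarrow> real" where
  "fne_radius A y x u = (1/2) * norm (y - A *v x - u)"

end

theory Submission
  imports Defs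
begin

text \<open>
  Writing \<open>r = y - A x - u\<close>, the gradient of \<open>f\<close> at \<open>A x\<close> is \<open>A x - y\<close>, so both balls have
  centre \<open>(u + y - A x) / 2\<close>. Dual feasibility of \<open>u\<close> forces the conjugate of the positively
  homogeneous penalty to vanish, and \<open>\<langle>u, A x\<rangle> = \<mu> \<parallel>x\<parallel>\<close> then turns the
  duality gap into the square \<open>\<parallel>r\<parallel>\<^sup>2 / 2\<close>; subtracting \<open>\<parallel>r\<parallel>\<^sup>2 / 4\<close> leaves \<open>(\<parallel>r\<parallel> / 2)\<^sup>2\<close>.
\<close>

lemma gradient_eqI:
  assumes "GDERIV f z :> d"
  shows "gradient f z = d"
  unfolding gradient_def
proof (rule the_equality)
  fix e assume "GDERIV f z :> e"
  then have "(\<lambda>h. h \<bullet> e) = (\<lambda>h. h \<bullet> d)"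
    using assms unfolding gderiv_def by (rule has_derivative_unique)
  then show "e = d"
    by (metis inner_commute vector_eq_rdot)
qed (fact assms)

lemma gradient_least_squares: "gradient (least_squares y) z = z - y"
proof (rule gradient_eqI)
  show "GDERIV (least_squares y) z :> z - y"
    unfolding gderiv_def least_squares_def power2_norm_eq_inner
    by (auto intro!: derivative_eq_intros
        simp: fun_eq_iff inner_diff inner_commute algebra_simps)
qed

text \<open>Completing the square in \<open>z\<close> leaves a constant minus half a square that
  vanishes at \<open>z = y + w\<close>, so the supremum is attained there.\<close>

lemma convex_conjugate_least_squares:
  "convex_conjugate (\<lambda>z. ereal (least_squares y z)) w = ereal (w \<bullet> y + (norm w)\<^sup>2 / 2)"
proof -
  have eq: "w \<bullet> z - least_squares y z = w \<bullet> y + (norm w)\<^sup>2 / 2 - (norm (z - y - w))\<^sup>2 / 2" for z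
    unfolding least_squares_def power2_norm_eq_inner
    by (simp add: inner_diff inner_add inner_commute field_simps)
  show ?thesis
    unfolding convex_conjugate_def
  proof (rule antisym)
    show "(SUP z. ereal (w \<bullet> z) - ereal (least_squares y z)) \<le> ereal (w \<bullet> y + (norm w)\<^sup>2 / 2)"
      by (rule SUP_least) (simp add: eq)
    show "ereal (w \<bullet> y + (norm w)\<^sup>2 / 2) \<le> (SUP z. ereal (w \<bullet> z) - ereal (least_squares y z))"
      by (rule SUP_upper2[where i = "y + w"]) (simp_all add: eq)
  qed
qed

text \<open>Along a ray \<open>w \<bullet> z - h z\<close> scales linearly, so a single positive
  value would make the supremum infinite; the origin contributes 0.\<close>

lemma convex_conjugate_pos_homogeneous:
  fixes h :: "'a::real_inner \<Rightarrow> real"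
  assumes hom: "\<And>t z. t \<ge> 0 \<Longrightarrow> h (t *\<^sub>R z) = t * h z"
    and fin: "convex_conjugate (\<lambda>z. ereal (h z)) w < \<infinity>"
  shows "convex_conjugate (\<lambda>z. ereal (h z)) w = 0"
proof -
  let ?c = "convex_conjugate (\<lambda>z. ereal (h z)) w"
  have upper: "ereal (w \<bullet> z - h z) \<le> ?c" for z
    unfolding convex_conjugate_def by (rule SUP_upper2[where i = z]) simp_all
  \<comment> \<open>The case \<open>t = 0\<close> of \<open>hom\<close> gives
    \<open>h 0 = 0\<close>.\<close>
  have nonneg: "0 \<le> ?c"
    using upper[of 0] hom[of 0 0] by (simp add: zero_ereal_def)
  then obtain b where b: "?c = ereal b" "b \<ge> 0"
    using fin by (cases ?c) auto
  have "w \<bullet> z - h z \<le> 0" for z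
  proof (rule ccontr)
    define a where "a = w \<bullet> z - h z"
    assume "\<not> w \<bullet> z - h z \<le> 0"
    then have "a > 0" by (simp add: a_def)
    \<comment> \<open>Scaling chosen so that \<open>t * a = b + 1\<close> overshoots the bound
      \<open>b\<close>.\<close>
    define t where "t = (b + 1) / a"
    have "t \<ge> 0" using \<open>a > 0\<close> b(2) by (simp add: t_def)
    have "t * a \<le> b"
      using upper[of "t *\<^sub>R z"] hom[OF \<open>t \<ge> 0\<close>, of z] b(1)
      by (simp add: a_def algebra_simps)
    then show False using \<open>a > 0\<close> by (simp add: t_def)
  qed
  then have "?c \<le> 0"
    unfolding convex_conjugate_def by (intro SUP_least) (simp add: zero_ereal_def)
  with nonneg show ?thesis by (rule antisym[rotated])
qed

theorem proposition4p7:
  fixes A :: "real^'n^'m" and y :: "real^'m" and \<mu> :: real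
    and x :: "real^'n" and u :: "real^'m"
  assumes "\<mu> > 0"
    and "x \<in> eff_domain (primal A (least_squares y) (l1_penalty \<mu>))"
    and "u \<in> eff_domain (\<lambda>v. - dual A (least_squares y) (l1_penalty \<mu>) v)"
    and "u \<bullet> (A *v x) = \<mu> * l1_norm x"
  shows "cball (fne_center A y x u) (fne_radius A y x u)
         = ryu_ball 1 A (least_squares y) (l1_penalty \<mu>) x u"
proof -
  let ?gc = "convex_conjugate (l1_penalty \<mu>) (transpose A *v u)"
  let ?r = "y - A *v x - u"
  have dual: "dual A (least_squares y) (l1_penalty \<mu>) u
      = - ereal (- (u \<bullet> y) + (norm u)\<^sup>2 / 2) - ?gc"
    by (simp add: dual_def convex_conjugate_least_squares)
  \<comment> \<open>An infinite \<open>?gc\<close> would make the negated dual objective infinite at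
    \<open>u\<close>.\<close>
  have "?gc < \<infinity>"
    using assms(3) by (cases ?gc) (simp_all add: eff_domain_def dual)
  moreover have "\<mu> * l1_norm (t *\<^sub>R z) = t * (\<mu> * l1_norm z)" if "t \<ge> 0" for t and z :: "real^'n"
    using that by (simp add: l1_norm_def abs_mult sum_distrib_left mult_ac)
  ultimately have "?gc = 0"
    unfolding l1_penalty_def by (intro convex_conjugate_pos_homogeneous)
  then have "primal A (least_squares y) (l1_penalty \<mu>) x - dual A (least_squares y) (l1_penalty \<mu>) u
      = ereal (least_squares y (A *v x) + u \<bullet> (A *v x) - u \<bullet> y + (norm u)\<^sup>2 / 2)"
    by (simp add: dual primal_def l1_penalty_def assms(4))
  \<comment> \<open>The cross terms combine to \<open>- (u \<bullet> (y - A *v x))\<close>, which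
    completes the square.\<close>
  also have "\<dots> = ereal ((norm ?r)\<^sup>2 / 2)"
    unfolding least_squares_def power2_norm_eq_inner
    by (simp add: inner_diff inner_add inner_commute field_simps)
  finally have gap: "primal A (least_squares y) (l1_penalty \<mu>) x
      - dual A (least_squares y) (l1_penalty \<mu>) u = ereal ((norm ?r)\<^sup>2 / 2)" .
  \<comment> \<open>The vector on the left is \<open>- ?r\<close>.\<close>
  have "norm (u + gradient (least_squares y) (A *v x)) = norm ?r"
    by (subst norm_minus_cancel[symmetric]) (simp add: gradient_least_squares algebra_simps)
  then have "ryu_radius 1 A (least_squares y) (l1_penalty \<mu>) x u = sqrt ((norm ?r / 2)\<^sup>2)"
    by (simp add: ryu_radius_def gap power_divide)
  then have "ryu_radius 1 A (least_squares y) (l1_penalty \<mu>) x u = fne_radius A y x u"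
    by (simp add: fne_radius_def)
  moreover have "ryu_center A (least_squares y) x u = fne_center A y x u"
    by (simp add: ryu_center_def fne_center_def gradient_least_squares vec_eq_iff field_simps)
  ultimately show ?thesis
    by (simp add: ryu_ball_def)
qed

end
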